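(* Suppose coherent downlink transmission with MR precoding based on the phase-aware MMSE estimator is used, i.e. $\mathbf w_k=\mathbf D_k^{1/2}\hat{\mathbf h}^{\mathrm{mmse}}_k$ for every UE $k$, where $\mathbf D_k=\mathrm{diag}\big(\rho_{1,k}/\mathbb E\{|\hat h^{\mathrm{mmse}}_{1,k}|^2\},\dots,\rho_{M,k}/\mathbb E\{|\hat h^{\mathrm{mmse}}_{M,k}|^2\}\big)$. Then for all UEs $k,l$: $$\mathbb E\{\mathbf w_k^H\mathbf h_k\}=\mathrm{tr}(\mathbf D_k^{1/2}\mathbf Z_k),$$ $$\mathbb E\{|\mathbf w_l^H\mathbf h_k|^2\}=\hat p_l\tau_p\mathrm{tr}(\mathbf D_l\mathbf R_k\boldsymbol\Omega_l)+\hat p_l\tau_p\mathrm{tr}(\mathbf D_l\boldsymbol\Omega_l\mathbf L_k)+\mathrm{tr}(\mathbf D_l\mathbf S_{l,k})+\mathrm{tr}(\mathbf D_l\mathbf R_k\mathbf L_l)+\Delta_{l,k},$$ where $\mathbf Z_k=\hat p_k\tau_p\boldsymbol\Omega_k+\mathbf L_k$, $\mathbf S_{l,k}=\mathbf L_l\mathbf L_k$ if $l\neq k$ and $\mathbf S_{k,k}=\mathbf 0$, and $$\Delta_{l,k}=\begin{cases}\hat p_k\hat p_l\tau_p^2\big|\mathrm{tr}(\mathbf D_l^{1/2}\mathbf R_k\boldsymbol\Lambda_l\mathbf R_l)\big|^2,& l\in\mathcal P_k\setminus\{k\},\\ \hat p_l^2\tau_p^2\big|\mathrm{tr}(\mathbf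 D_l^{1/2}\boldsymbol\Omega_l)\big|^2+\big(\mathrm{tr}(\mathbf D_l^{1/2}\mathbf L_l)\big)^2+2\hat p_l\tau_p\mathrm{tr}(\mathbf D_l^{1/2}\boldsymbol\Omega_l)\,\mathrm{tr}(\mathbf D_l^{1/2}\mathbf L_l),& l=k,\\ 0,& l\notin\mathcal P_k.\end{cases}$$ Consequently the coherent downlink effective SINR of UE $k$ equals $$\gamma^{\mathrm{dl,mmse}}_k=\frac{\big|\mathrm{tr}(\mathbf D_k^{1/2}\mathbf Z_k)\big|^2}{\sum_{l=1}^K\mathrm{tr}(\mathbf D_l\mathbf R'_k\mathbf Z_l)+\sum_{l\in\mathcal P_k\setminus\{k\}}\hat p_k\hat p_l\tau_p^2\big|\mathrm{tr}(\mathbf D_l^{1/2}\mathbf R_k\boldsymbol\Lambda_l\mathbf R_l)\big|^2-\mathrm{tr}(\mathbf D_k\mathbf L_k^2)+\sigma^2_{\mathrm{dl}}}.$$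
   Context: Channels. There are $M$ single-antenna access points (APs) and $K$ single-antenna users (UEs). The channel between AP $m$ and UE $k$ is $h_{m,k}=\bar h_{m,k}e^{j\varphi_{m,k}}+g_{m,k}$, with $\bar h_{m,k}\ge 0$ deterministic, $\varphi_{m,k}$ uniform on $[-\pi,\pi]$, $g_{m,k}\sim\mathcal N_{\mathbb C}(0,\beta_{m,k})$ (circularly symmetric complex Gaussian), $\beta_{m,k}>0$; all $\varphi_{m,k},g_{m,k}$ are mutually independent over $m,k$. Write $\mathbf h_k=[h_{1,k},\dots,h_{M,k}]^T$. Pilots. $\tau_p<K$ is the pilot length. Each UE uses one of $\tau_p$ mutually orthogonal pilot sequences $\boldsymbol\phi_k\in\mathbb C^{\tau_p}$ with $\|\boldsymbol\phi_k\|^2=\tau_p$, with pilot power $\hat p_k>0$. $\mathcal P_k$ is the set of UEs using the same pilot as UE $k$ (including $k$). After correlation with the pilot, AP $m$ has $$y^p_{m,k}=\sum_{l\in\mathcal P_k}\sqrt{\hat p_l}\,\tau_p h_{m,l}+\boldsymbol\phi_k^H\mathbf n^p_m,$$ where the $\mathbf n^p_m\sim\mathcal N_{\mathbb C}(\mathbf 0,\sigma^2_{\mathrm{ul}}\mathbf I_{\tau_p})$ are independent over $m$ and independent of all channels, and $\sigma^2_{\mathrm{ul}}>0$. Phase-aware MMSE estimator: $$\hat h^{\mathrm{mmse}}_{m,k}=\bar h_{m,k}e^{j\varphi_{m,k}}+\frac{\sqrt{\hat p_k}\,\beta_{m,k}(y^p_{m,k}-\bar y^p_{m,k})}{\lambda_{m,k}},$$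 with $\bar y^p_{m,k}=\sum_{l\in\mathcal P_k}\sqrt{\hat p_l}\tau_p\bar h_{m,l}e^{j\varphi_{m,l}}$, $\lambda_{m,k}=\sum_{l\in\mathcal P_k}\hat p_l\tau_p\beta_{m,l}+\sigma^2_{\mathrm{ul}}$; $\hat{\mathbf h}^{\mathrm{mmse}}_k=[\hat h^{\mathrm{mmse}}_{1,k},\dots,\hat h^{\mathrm{mmse}}_{M,k}]^T$. Matrices (all $M\times M$ diagonal): $\mathbf R_k=\mathrm{diag}(\beta_{1,k},\dots,\beta_{M,k})$, $\mathbf L_k=\mathrm{diag}(\bar h_{1,k}^2,\dots,\bar h_{M,k}^2)$, $\mathbf R'_k=\mathbf R_k+\mathbf L_k$, $\boldsymbol\Lambda_k=\mathrm{diag}(\lambda_{1,k},\dots,\lambda_{M,k})^{-1}$, $\boldsymbol\Omega_k=\mathbf R_k\boldsymbol\Lambda_k\mathbf R_k$. Coherent downlink. The powers $\rho_{m,k}\ge 0$ are deterministic (with $\sum_{l}\rho_{m,l}\le\rho^{\mathrm{dl}}$ for each AP $m$). UE $k$ receives $\mathbf h_k^H\mathbf w_k\varsigma_k+\sum_{l\ne k}\mathbf h_k^H\mathbf w_l\varsigma_l+n^{\mathrm{dl}}_k$ with independent unit-variance data symbols $\varsigma_l\sim\mathcal N_{\mathbb C}(0,1)$ and noise $n^{\mathrm{dl}}_k\sim\mathcal N_{\mathbb C}(0,\sigma^2_{\mathrm{dl}})$, $\sigma^2_{\mathrm{dl}}>0$. The coherent downlink effective SINR of UE $k$ (from the use-and-then-forget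 bound, SE $=\frac{\tau_d}{\tau_c}\log_2(1+\gamma)$) is defined as $$\gamma^{\mathrm{dl,coh}}_k=\frac{|\mathbb E\{\mathbf w_k^H\mathbf h_k\}|^2}{\sum_{l=1}^K\mathbb E\{|\mathbf w_l^H\mathbf h_k|^2\}-|\mathbb E\{\mathbf w_k^H\mathbf h_k\}|^2+\sigma^2_{\mathrm{dl}}}.$$ *)

theory Defs
  imports "HOL-Probability.Probability"
begin

definition herm_inner :: "complex ^ 'n \<Rightarrow> complex ^ 'n \<Rightarrow> complex" where
  "herm_inner u v = (\<Sum>i\<in>UNIV. cnj (u $ i) * (v $ i))"

definition diag :: "real ^ 'n \<Rightarrow> real ^ 'n ^ 'n" where
  "diag v = (\<chi> i j. if i = j then v $ i else 0)"

text \<open>The power \<open>A\<^sup>1\<^sup>/\<^sup>2\<close> is only ever taken of a diagonal matrix with nonnegative entries.\<close>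

definition diag_sqrt :: "real ^ 'n ^ 'n \<Rightarrow> real ^ 'n ^ 'n" where
  "diag_sqrt A = diag (\<chi> i. sqrt (A $ i $ i))"

lemma diag_sqrt_square:
  fixes v :: "real ^ 'n"
  assumes "\<And>i. 0 \<le> v $ i"
  shows "diag_sqrt (diag v) ** diag_sqrt (diag v) = diag v"
proof -
  have entry: "diag u $ i $ j = of_bool (i = j) * u $ i" for u :: "real ^ 'n" and i j
    by (simp add: diag_def)
  have "(diag_sqrt (diag v) ** diag_sqrt (diag v)) $ i $ j = diag v $ i $ j" for i j
  proof -
    have "(diag_sqrt (diag v) ** diag_sqrt (diag v)) $ i $ j
        = (\<Sum>k\<in>UNIV. if k = i then of_bool (k = j) * (sqrt (v $ i) * sqrt (v $ i)) else 0)"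
      unfolding matrix_matrix_mult_def diag_sqrt_def vec_lambda_beta entry
      by (rule sum.cong) auto
    then show ?thesis
      using assms[of i] by (simp add: entry)
  qed
  then show ?thesis
    by (simp add: vec_eq_iff)
qed

text \<open>The circularly symmetric complex Gaussian law with variance \<open>v > 0\<close>: independent real and
  imaginary parts, each of mean 0 and variance \<open>v / 2\<close> (the library's normal density takes the
  standard deviation).\<close>

definition complex_normal :: "'w measure \<Rightarrow> ('w \<Rightarrow> complex) \<Rightarrow> real \<Rightarrow> bool" where
  "complex_normal M X v \<longleftrightarrow>
     distributed M lborel (\<lambda>x. Re (X x)) (\<lambda>t. ennreal (normal_density 0 (sqrt (v / 2)) t)) \<and>
     distributed M lborel (\<lambda>x. Im (X x)) (\<lambda>t. ennreal (normal_density 0 (sqrt (v / 2)) t)) \<and>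
     prob_space.indep_var M borel (\<lambda>x. Re (X x)) borel (\<lambda>x. Im (X x))"

text \<open>The vector law with mean 0 and covariance matrix \<open>v I\<close>.\<close>

definition complex_normal_vec :: "'w measure \<Rightarrow> ('w \<Rightarrow> complex ^ 'n) \<Rightarrow> real \<Rightarrow> bool" where
  "complex_normal_vec M X v \<longleftrightarrow>
     (\<forall>i. complex_normal M (\<lambda>x. X x $ i) v) \<and>
     prob_space.indep_vars M (\<lambda>_. borel) (\<lambda>i x. X x $ i) UNIV"

definition generated_events :: "'w measure \<Rightarrow> ('w \<Rightarrow> 'b::topological_space) \<Rightarrow> 'w set set" where
  "generated_events M X = {X -` A \<inter> space M | A. A \<in> sets borel}"

text \<open>Access points are the elements of \<open>'m\<close>, users those of \<open>'k\<close>; \<open>'t\<close> indexes both the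
  orthogonal pilot sequences and their entries, so that the pilot length is \<open>CARD('t)\<close>.\<close>

record ('w, 'm, 'k, 't::finite) cell_free =
  prob_sp :: "'w measure"
  hbar :: "'m \<Rightarrow> 'k \<Rightarrow> real"
  beta :: "'m \<Rightarrow> 'k \<Rightarrow> real"
  phase :: "'m \<Rightarrow> 'k \<Rightarrow> 'w \<Rightarrow> real"
  scatter :: "'m \<Rightarrow> 'k \<Rightarrow> 'w \<Rightarrow> complex"
  pilot_noise :: "'m \<Rightarrow> 'w \<Rightarrow> complex ^ 't"
  pilot_seq :: "'t \<Rightarrow> complex ^ 't"
  pilot_index :: "'k \<Rightarrow> 't"
  pilot_pow :: "'k \<Rightarrow> real"
  ul_noise_var :: real
  dl_pow :: "'m \<Rightarrow> 'k \<Rightarrow> real"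
  dl_pow_max :: real
  dl_noise_var :: real

text \<open>Phases, scattered components and pilot noise take values in three different types, so their
  joint independence is stated through the generated events, indexed by the following type.\<close>

datatype ('m, 'k) source = Phase 'm 'k | Scatter 'm 'k | Noise 'm

primrec source_events :: "('w, 'm, 'k, 't::finite) cell_free \<Rightarrow> ('m, 'k) source \<Rightarrow> 'w set set" where
  "source_events S (Phase m k) = generated_events (prob_sp S) (phase S m k)"
| "source_events S (Scatter m k) = generated_events (prob_sp S) (scatter S m k)"
| "source_events S (Noise m) = generated_events (prob_sp S) (pilot_noise S m)"

locale cell_free_model =
  fixes S :: "('w, 'm::finite, 'k::finite, 't::finite) cell_free"
  assumes prob_space_prob_sp: "prob_space (prob_sp S)"
    and hbar_nonneg: "0 \<le> hbar S m k"
    and beta_pos: "0 < beta S m k"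
    and phase_uniform: "distributed (prob_sp S) lborel (phase S m k)
      (\<lambda>x. indicator {- pi..pi} x / measure lborel {- pi..pi})"
    and scatter_normal: "complex_normal (prob_sp S) (scatter S m k) (beta S m k)"
    and pilot_noise_normal: "complex_normal_vec (prob_sp S) (pilot_noise S m) (ul_noise_var S)"
    and sources_indep: "prob_space.indep_sets (prob_sp S) (source_events S) UNIV"
    and few_pilots: "CARD('t) < CARD('k)"
    and pilot_norm: "(norm (pilot_seq S s))\<^sup>2 = real CARD('t)"
    and pilot_orthogonal: "s \<noteq> s' \<Longrightarrow> herm_inner (pilot_seq S s) (pilot_seq S s') = 0"
    and pilot_pow_pos: "0 < pilot_pow S k"
    and ul_noise_var_pos: "0 < ul_noise_var S"
    and dl_pow_nonneg: "0 \<le> dl_pow S m k"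
    and dl_pow_bound: "(\<Sum>l\<in>UNIV. dl_pow S m l) \<le> dl_pow_max S"
    and dl_noise_var_pos: "0 < dl_noise_var S"

definition pilot_len :: "('w, 'm, 'k, 't::finite) cell_free \<Rightarrow> real" where
  "pilot_len S = real CARD('t)"

definition chan :: "('w, 'm::finite, 'k, 't::finite) cell_free \<Rightarrow> 'k \<Rightarrow> 'w \<Rightarrow> complex ^ 'm" where
  "chan S k x = (\<chi> m. of_real (hbar S m k) * cis (phase S m k x) + scatter S m k x)"

definition copilot :: "('w, 'm, 'k, 't::finite) cell_free \<Rightarrow> 'k \<Rightarrow> 'k set" where
  "copilot S k = {l. pilot_index S l = pilot_index S k}"

definition pilot_obs :: "('w, 'm::finite, 'k::finite, 't::finite) cell_free \<Rightarrow> 'm \<Rightarrow> 'k \<Rightarrow> 'w \<Rightarrow> complex" where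
  "pilot_obs S m k x =
     (\<Sum>l\<in>copilot S k. of_real (sqrt (pilot_pow S l) * pilot_len S) * chan S l x $ m)
     + herm_inner (pilot_seq S (pilot_index S k)) (pilot_noise S m x)"

definition pilot_obs_mean :: "('w, 'm, 'k::finite, 't::finite) cell_free \<Rightarrow> 'm \<Rightarrow> 'k \<Rightarrow> 'w \<Rightarrow> complex" where
  "pilot_obs_mean S m k x =
     (\<Sum>l\<in>copilot S k. of_real (sqrt (pilot_pow S l) * pilot_len S * hbar S m l) * cis (phase S m l x))"

definition lam :: "('w, 'm, 'k::finite, 't::finite) cell_free \<Rightarrow> 'm \<Rightarrow> 'k \<Rightarrow> real" where
  "lam S m k = (\<Sum>l\<in>copilot S k. pilot_pow S l * pilot_len S * beta S m l) + ul_noise_var S"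

definition mmse_est :: "('w, 'm::finite, 'k::finite, 't::finite) cell_free \<Rightarrow> 'k \<Rightarrow> 'w \<Rightarrow> complex ^ 'm" where
  "mmse_est S k x = (\<chi> m. of_real (hbar S m k) * cis (phase S m k x)
     + of_real (sqrt (pilot_pow S k) * beta S m k) * (pilot_obs S m k x - pilot_obs_mean S m k x)
         / of_real (lam S m k))"

definition Rmat :: "('w, 'm::finite, 'k, 't::finite) cell_free \<Rightarrow> 'k \<Rightarrow> real ^ 'm ^ 'm" where
  "Rmat S k = diag (\<chi> m. beta S m k)"

definition Lmat :: "('w, 'm::finite, 'k, 't::finite) cell_free \<Rightarrow> 'k \<Rightarrow> real ^ 'm ^ 'm" where
  "Lmat S k = diag (\<chi> m. (hbar S m k)\<^sup>2)"

definition Rmat' :: "('w, 'm::finite, 'k, 't::finite) cell_free \<Rightarrow> 'k \<Rightarrow> real ^ 'm ^ 'm" where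
  "Rmat' S k = Rmat S k + Lmat S k"

definition Lammat :: "('w, 'm::finite, 'k::finite, 't::finite) cell_free \<Rightarrow> 'k \<Rightarrow> real ^ 'm ^ 'm" where
  "Lammat S k = matrix_inv (diag (\<chi> m. lam S m k))"

definition Ommat :: "('w, 'm::finite, 'k::finite, 't::finite) cell_free \<Rightarrow> 'k \<Rightarrow> real ^ 'm ^ 'm" where
  "Ommat S k = Rmat S k ** Lammat S k ** Rmat S k"

definition Dmat :: "('w, 'm::finite, 'k::finite, 't::finite) cell_free \<Rightarrow> 'k \<Rightarrow> real ^ 'm ^ 'm" where
  "Dmat S k = diag (\<chi> m. dl_pow S m k / (\<integral>x. (cmod (mmse_est S k x $ m))\<^sup>2 \<partial>prob_sp S))"

definition Zmat :: "('w, 'm::finite, 'k::finite, 't::finite) cell_free \<Rightarrow> 'k \<Rightarrow> real ^ 'm ^ 'm" where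
  "Zmat S k = (pilot_pow S k * pilot_len S) *\<^sub>R Ommat S k + Lmat S k"

definition Smat :: "('w, 'm::finite, 'k, 't::finite) cell_free \<Rightarrow> 'k \<Rightarrow> 'k \<Rightarrow> real ^ 'm ^ 'm" where
  "Smat S l k = (if l = k then 0 else Lmat S l ** Lmat S k)"

definition Delta :: "('w, 'm::finite, 'k::finite, 't::finite) cell_free \<Rightarrow> 'k \<Rightarrow> 'k \<Rightarrow> real" where
  "Delta S l k =
     (if l \<in> copilot S k - {k} then
        pilot_pow S k * pilot_pow S l * (pilot_len S)\<^sup>2
          * \<bar>trace (diag_sqrt (Dmat S l) ** Rmat S k ** Lammat S l ** Rmat S l)\<bar>\<^sup>2
      else if l = k then
        (pilot_pow S l)\<^sup>2 * (pilot_len S)\<^sup>2 * \<bar>trace (diag_sqrt (Dmat S l) ** Ommat S l)\<bar>\<^sup>2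
          + (trace (diag_sqrt (Dmat S l) ** Lmat S l))\<^sup>2
          + 2 * pilot_pow S l * pilot_len S * trace (diag_sqrt (Dmat S l) ** Ommat S l)
              * trace (diag_sqrt (Dmat S l) ** Lmat S l)
      else 0)"

text \<open>The effective SINR for an arbitrary family of precoding vectors \<open>w\<close>.\<close>

definition sinr_dl_coh ::
  "('w, 'm::finite, 'k::finite, 't::finite) cell_free \<Rightarrow> ('k \<Rightarrow> 'w \<Rightarrow> complex ^ 'm) \<Rightarrow> 'k \<Rightarrow> real" where
  "sinr_dl_coh S w k =
     (cmod (\<integral>x. herm_inner (w k x) (chan S k x) \<partial>prob_sp S))\<^sup>2
     / ((\<Sum>l\<in>UNIV. \<integral>x. (cmod (herm_inner (w l x) (chan S k x)))\<^sup>2 \<partial>prob_sp S)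
        - (cmod (\<integral>x. herm_inner (w k x) (chan S k x) \<partial>prob_sp S))\<^sup>2 + dl_noise_var S)"

definition sinr_dl_mmse :: "('w, 'm::finite, 'k::finite, 't::finite) cell_free \<Rightarrow> 'k \<Rightarrow> real" where
  "sinr_dl_mmse S k =
     \<bar>trace (diag_sqrt (Dmat S k) ** Zmat S k)\<bar>\<^sup>2
     / ((\<Sum>l\<in>UNIV. trace (Dmat S l ** Rmat' S k ** Zmat S l))
        + (\<Sum>l\<in>copilot S k - {k}. pilot_pow S k * pilot_pow S l * (pilot_len S)\<^sup>2
             * \<bar>trace (diag_sqrt (Dmat S l) ** Rmat S k ** Lammat S l ** Rmat S l)\<bar>\<^sup>2)
        - trace (Dmat S k ** (Lmat S k ** Lmat S k)) + dl_noise_var S)"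

end

theory Submission
  imports Defs
begin

text \<open>At each access point the summand of \<open>\<bold>w\<^sub>l\<^sup>H \<bold>h\<^sub>k\<close> is, up to a constant,
  \<open>cnj (A + t G + W) (B + G)\<close>, where \<open>A\<close>, \<open>B\<close> are the line-of-sight components of users \<open>l\<close>, \<open>k\<close>,
  \<open>G\<close> is the scattered component of user \<open>k\<close> (with \<open>t = 0\<close> unless the pilots agree) and \<open>W\<close> is the
  remaining contamination and noise. Since \<open>A\<close>, \<open>B\<close> have constant modulus and the Gaussian \<open>G\<close> has
  \<open>E G = E G\<^sup>2 = E |G|\<^sup>2G = 0\<close>, only a few terms of the expansion survive, and the second moment is
  the squared mean plus a variance. The summands are independent over the access points, so the
  second moment of their sum is the sum of the variances plus the square of the total mean; that
  square is \<open>\<Delta>\<^sub>l\<^sub>,\<^sub>k\<close>.\<close>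

section \<open>Independence of blocks and second moments of weighted sums\<close>

lemma has_bochner_integral_eqI:
  assumes "has_bochner_integral M f a" "\<And>x. f x = g x" "a = b"
  shows "has_bochner_integral M g b"
  using assms by (simp cong: has_bochner_integral_cong)

text \<open>Disjoint subfamilies of an independent family form independent tuples. Requiring
  \<open>f\<close> and \<open>g\<close> to ignore the coordinates outside their block removes
  \<open>restrict\<close> from the conclusion, so both may be written with the whole family.\<close>

lemma (in prob_space) indep_var_blocks:
  assumes V: "indep_vars (\<lambda>_. borel) V K"
    and disj: "I \<inter> J = {}" and "I \<subseteq> K" "J \<subseteq> K"
    and f: "f \<in> borel_measurable (PiM I (\<lambda>_. borel))" "\<And>v. f (restrict v I) = f v"
    and g: "g \<in> borel_measurable (PiM J (\<lambda>_. borel))" "\<And>v. g (restrict v J) = g v"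
  shows "indep_var borel (\<lambda>x. f (\<lambda>i. V i x)) borel (\<lambda>x. g (\<lambda>i. V i x))"
  using indep_var_compose[OF indep_var_restrict[OF V disj \<open>I \<subseteq> K\<close> \<open>J \<subseteq> K\<close>] f(1) g(1)]
  by (simp add: comp_def f(2) g(2))

lemma (in prob_space) indep_var_has_bochner_integral_mult:
  fixes X Y :: "'a \<Rightarrow> 'b::{real_normed_field,banach,second_countable_topology}"
  assumes "indep_var borel X borel Y" "has_bochner_integral M X a" "has_bochner_integral M Y b"
  shows "has_bochner_integral M (\<lambda>x. X x * Y x) (a * b)"
  using assms indep_var_integrable[of X Y] indep_var_lebesgue_integral[of X Y]
  by (auto simp: has_bochner_integral_iff)

lemma (in prob_space) indep_var_apply:
  assumes "indep_var borel X borel Y" "f \<in> borel_measurable borel" "g \<in> borel_measurable borel"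
  shows "indep_var borel (\<lambda>x. f (X x)) borel (\<lambda>x. g (Y x))"
  using indep_var_compose[OF assms] by (simp add: comp_def)

lemma norm_sum_square_complex:
  "complex_of_real ((cmod (\<Sum>i\<in>I. z i))\<^sup>2) = (\<Sum>i\<in>I. \<Sum>j\<in>I. z i * cnj (z j))"
  by (simp only: complex_norm_square cnj_sum sum_product)

text \<open>Pairwise independence factors the off-diagonal expectations in the expanded square. The
  computation runs over the complex numbers, where the single summands live, and returns to the
  reals by taking real parts at the end.\<close>

lemma (in prob_space) second_moment_sum:
  fixes X :: "'i \<Rightarrow> 'a \<Rightarrow> complex"
  assumes "finite I"
    and mean: "\<And>i. i \<in> I \<Longrightarrow> has_bochner_integral M (X i) (\<mu> i)"
    and second: "\<And>i. i \<in> I \<Longrightarrow> has_bochner_integral M (\<lambda>x. (cmod (X i x))\<^sup>2) (s i)"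
    and indep: "\<And>i j. i \<in> I \<Longrightarrow> j \<in> I \<Longrightarrow> i \<noteq> j \<Longrightarrow> indep_var borel (X i) borel (X j)"
  shows "has_bochner_integral M (\<lambda>x. (cmod (\<Sum>i\<in>I. c i * X i x))\<^sup>2)
    ((\<Sum>i\<in>I. (cmod (c i))\<^sup>2 * (s i - (cmod (\<mu> i))\<^sup>2)) + (cmod (\<Sum>i\<in>I. c i * \<mu> i))\<^sup>2)"
proof -
  define q where "q i j = (if i = j then complex_of_real (s i) else \<mu> i * cnj (\<mu> j))" for i j
  have q: "has_bochner_integral M (\<lambda>x. X i x * cnj (X j x)) (q i j)" if "i \<in> I" "j \<in> I" for i j
  proof (cases "i = j")
    case True
    then show ?thesis
      using has_bochner_integral_of_real[where 'a=complex, OF second[OF \<open>i \<in> I\<close>]]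
      by (simp add: q_def complex_norm_square del: of_real_power)
  next
    case False
    have "indep_var borel (X i) borel (\<lambda>x. cnj (X j x))"
      using indep_var_apply[OF indep[OF that False], of "\<lambda>z. z" cnj]
      by (simp add: borel_measurable_continuous_onI continuous_intros)
    from indep_var_has_bochner_integral_mult[OF this mean has_bochner_integral_cnj[OF mean]] that False
    show ?thesis by (simp add: q_def)
  qed
  have "has_bochner_integral M (\<lambda>x. \<Sum>i\<in>I. \<Sum>j\<in>I. (c i * cnj (c j)) * (X i x * cnj (X j x)))
      (\<Sum>i\<in>I. \<Sum>j\<in>I. (c i * cnj (c j)) * q i j)"
    by (intro has_bochner_integral_sum has_bochner_integral_mult_right q)
  also have "(\<lambda>x. \<Sum>i\<in>I. \<Sum>j\<in>I. (c i * cnj (c j)) * (X i x * cnj (X j x)))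
      = (\<lambda>x. complex_of_real ((cmod (\<Sum>i\<in>I. c i * X i x))\<^sup>2))"
    unfolding norm_sum_square_complex by (simp add: mult_ac)
  \<comment> \<open>The diagonal is completed by the squared means, so that the double sum becomes a
    perfect square and the variances remain as correction.\<close>
  also have "(\<Sum>i\<in>I. \<Sum>j\<in>I. (c i * cnj (c j)) * q i j)
      = (\<Sum>i\<in>I. \<Sum>j\<in>I. (c i * \<mu> i) * cnj (c j * \<mu> j)
          + (if j = i then c i * cnj (c i) * (of_real (s i) - \<mu> i * cnj (\<mu> i)) else 0))"
    by (intro sum.cong refl) (simp add: q_def algebra_simps)
  also have "\<dots> = (\<Sum>i\<in>I. \<Sum>j\<in>I. (c i * \<mu> i) * cnj (c j * \<mu> j))
      + (\<Sum>i\<in>I. c i * cnj (c i) * (of_real (s i) - \<mu> i * cnj (\<mu> i)))"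
    using \<open>finite I\<close> by (simp add: sum.distrib)
  also have "\<dots> = of_real ((\<Sum>i\<in>I. (cmod (c i))\<^sup>2 * (s i - (cmod (\<mu> i))\<^sup>2)) + (cmod (\<Sum>i\<in>I. c i * \<mu> i))\<^sup>2)"
    unfolding norm_sum_square_complex[symmetric]
    by (simp add: complex_norm_square del: of_real_power)
  finally show ?thesis
    using has_bochner_integral_Re[of M "\<lambda>x. complex_of_real (_ x)"] by fastforce
qed

section \<open>Moments of the complex Gaussian law and of the uniform phase\<close>

lemma (in prob_space) normal_distributed_moments:
  assumes "0 < v"
    and X: "distributed M lborel X (\<lambda>t. ennreal (normal_density 0 (sqrt (v / 2)) t))"
  shows "has_bochner_integral M X 0"
    and "has_bochner_integral M (\<lambda>x. (X x)\<^sup>2) (v / 2)"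
    and "has_bochner_integral M (\<lambda>x. (X x) ^ 3) 0"
    and "has_bochner_integral M (\<lambda>x. (X x) ^ 4) (3 * v\<^sup>2 / 4)"
proof -
  have s: "0 < sqrt (v / 2)" using \<open>0 < v\<close> by simp
  \<comment> \<open>Below, the last instantiated index n of the library moments selects the power 2n
    + 1 in the odd case and 2n in the even case. The variance is \<open>v / 2\<close>, so the fourth
    moment is \<open>3 * (v / 2)^2\<close>.\<close>
  have transfer: "has_bochner_integral M (\<lambda>x. X x ^ n) e"
    if "has_bochner_integral lborel (\<lambda>x. normal_density 0 (sqrt (v / 2)) x * (x - 0) ^ n) e" for n e
    using that distributed_integrable[OF X, of "\<lambda>x. x ^ n"] distributed_integral[OF X, of "\<lambda>x. x ^ n"]
    by (simp add: has_bochner_integral_iff)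
  show "has_bochner_integral M X 0"
    using transfer[OF normal_moment_odd[OF s, of 0 0]] by simp
  show "has_bochner_integral M (\<lambda>x. (X x)\<^sup>2) (v / 2)"
    using transfer[OF normal_moment_even[OF s, of 0 1]] \<open>0 < v\<close> by (simp add: field_simps power2_eq_square)
  show "has_bochner_integral M (\<lambda>x. (X x) ^ 3) 0"
    using transfer[OF normal_moment_odd[OF s, of 0 1]] by (simp add: eval_nat_numeral)
  show "has_bochner_integral M (\<lambda>x. (X x) ^ 4) (3 * v\<^sup>2 / 4)"
    using transfer[OF normal_moment_even[OF s, of 0 2]] \<open>0 < v\<close>
    by (simp add: field_simps eval_nat_numeral)
qed

text \<open>All five are polynomials in the real and imaginary part, and independence factors the
  mixed monomials. In the square the two variances cancel; the fourth moment is
  \<open>3/4 + 2 * 1/4 + 3/4 = 2\<close> times \<open>v^2\<close>.\<close>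

lemma (in prob_space) complex_normal_moments:
  assumes "0 < v" and X: "complex_normal M X v"
  shows "has_bochner_integral M X 0"
    and "has_bochner_integral M (\<lambda>x. (X x)\<^sup>2) 0"
    and "has_bochner_integral M (\<lambda>x. (cmod (X x))\<^sup>2) v"
    and "has_bochner_integral M (\<lambda>x. of_real ((cmod (X x))\<^sup>2) * X x) 0"
    and "has_bochner_integral M (\<lambda>x. (cmod (X x)) ^ 4) (2 * v\<^sup>2)"
proof -
  let ?R = "\<lambda>x. Re (X x)" and ?I = "\<lambda>x. Im (X x)"
  have ind: "indep_var borel ?R borel ?I"
    and R: "distributed M lborel ?R (\<lambda>t. ennreal (normal_density 0 (sqrt (v / 2)) t))"
    and I: "distributed M lborel ?I (\<lambda>t. ennreal (normal_density 0 (sqrt (v / 2)) t))"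
    using X by (auto simp: complex_normal_def)
  note R = normal_distributed_moments[OF \<open>0 < v\<close> R]
  note I = normal_distributed_moments[OF \<open>0 < v\<close> I]
  have ind2: "indep_var borel (\<lambda>x. ?R x ^ p) borel (\<lambda>x. ?I x ^ q)" for p q
    using indep_var_apply[OF ind, of "\<lambda>x. x ^ p" "\<lambda>x. x ^ q"] by simp
  note mult = indep_var_has_bochner_integral_mult[OF ind2]
  have RI: "has_bochner_integral M (\<lambda>x. ?R x * ?I x) 0"
    using mult[of 1 0 1 0] R I by simp
  have R2I: "has_bochner_integral M (\<lambda>x. (?R x)\<^sup>2 * ?I x) 0"
    using mult[of 2 "v/2" 1 0] R I by simp
  have RI2: "has_bochner_integral M (\<lambda>x. ?R x * (?I x)\<^sup>2) 0"
    using mult[of 1 0 2 "v/2"] R I by simp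
  have R2I2: "has_bochner_integral M (\<lambda>x. (?R x)\<^sup>2 * (?I x)\<^sup>2) (v\<^sup>2 / 4)"
    using mult[of 2 "v/2" 2 "v/2"] R I by (simp add: power2_eq_square)
  have complexI: "has_bochner_integral M f 0"
    if "has_bochner_integral M (\<lambda>x. Re (f x)) 0" "has_bochner_integral M (\<lambda>x. Im (f x)) 0" for f
    using has_bochner_integral_add[OF has_bochner_integral_of_real[where 'a=complex, OF that(1)]
        has_bochner_integral_mult_right[where c=\<i>, OF has_bochner_integral_of_real[where 'a=complex, OF that(2)]]]
    by (simp add: complex_eq[symmetric])
  show "has_bochner_integral M X 0"
    by (intro complexI R I)
  show "has_bochner_integral M (\<lambda>x. (X x)\<^sup>2) 0"
  proof (rule complexI)
    show "has_bochner_integral M (\<lambda>x. Re ((X x)\<^sup>2)) 0"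
      using has_bochner_integral_diff[OF R(2) I(2)] by (simp add: power2_eq_square)
    show "has_bochner_integral M (\<lambda>x. Im ((X x)\<^sup>2)) 0"
      using has_bochner_integral_mult_right[where c=2, OF RI] by (simp add: power2_eq_square mult_ac)
  qed
  show "has_bochner_integral M (\<lambda>x. (cmod (X x))\<^sup>2) v"
    using has_bochner_integral_add[OF R(2) I(2)] by (simp add: cmod_power2)
  show "has_bochner_integral M (\<lambda>x. of_real ((cmod (X x))\<^sup>2) * X x) 0"
  proof (rule complexI)
    show "has_bochner_integral M (\<lambda>x. Re (of_real ((cmod (X x))\<^sup>2) * X x)) 0"
      using has_bochner_integral_add[OF R(3) RI2]
      by (simp add: cmod_power2 del: of_real_power of_real_add)
        (simp add: algebra_simps eval_nat_numeral)
    show "has_bochner_integral M (\<lambda>x. Im (of_real ((cmod (X x))\<^sup>2) * X x)) 0"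
      using has_bochner_integral_add[OF I(3) R2I]
      by (simp add: cmod_power2 del: of_real_power of_real_add)
        (simp add: algebra_simps eval_nat_numeral)
  qed
  have "cmod z ^ 4 = Re z ^ 4 + (2 * ((Re z)\<^sup>2 * (Im z)\<^sup>2) + Im z ^ 4)" for z
  proof -
    have "cmod z ^ 4 = ((cmod z)\<^sup>2)\<^sup>2" by simp
    then show ?thesis unfolding cmod_power2 by (simp add: power2_eq_square algebra_simps eval_nat_numeral)
  qed
  then show "has_bochner_integral M (\<lambda>x. (cmod (X x)) ^ 4) (2 * v\<^sup>2)"
    using has_bochner_integral_add[OF R(4) has_bochner_integral_add[OF
          has_bochner_integral_mult_right[where c=2, OF R2I2] I(4)]]
    by (simp add: algebra_simps)
qed

lemma (in prob_space) uniform_phase_expectation: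
  assumes "distributed M lborel \<phi> (\<lambda>x. indicator {- pi..pi} x / measure lborel {- pi..pi})"
  shows "has_bochner_integral M (\<lambda>x. cis (\<phi> x)) 0"
proof -
  let ?d = "\<lambda>x. indicator {- pi..pi} x / measure lborel {- pi..pi} :: real"
  \<comment> \<open>An antiderivative with equal values at both ends of the interval makes the
    integral against the constant density vanish; sine and negated cosine are used for it.\<close>
  have transfer: "has_bochner_integral M (\<lambda>x. g (\<phi> x)) 0"
    if "\<And>x. (G has_real_derivative g x) (at x)" "G pi = G (- pi)" "\<And>x. isCont g x" for g G :: "real \<Rightarrow> real"
  proof -
    have [measurable]: "g \<in> borel_measurable borel"
      using that(3) by (intro borel_measurable_continuous_onI) (simp add: continuous_at_imp_continuous_on)
    have "has_bochner_integral lborel (\<lambda>x. g x * indicator {- pi..pi} x) (G pi - G (- pi))"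
      using that by (intro has_bochner_integral_FTC_Icc_real) auto
    then have "has_bochner_integral lborel (\<lambda>x. ?d x * g x) 0"
      using has_bochner_integral_mult_left[where c="1 / measure lborel {- pi..pi}"] that(2) by (fastforce simp: mult_ac)
    then show ?thesis
      using distributed_integrable[OF assms, of g] distributed_integral[OF assms, of g]
      by (simp add: has_bochner_integral_iff)
  qed
  have "has_bochner_integral M (\<lambda>x. cos (\<phi> x)) 0"
    by (rule transfer[of sin]) (auto intro!: derivative_eq_intros)
  moreover have "has_bochner_integral M (\<lambda>x. sin (\<phi> x)) 0"
    by (rule transfer[of "\<lambda>x. - cos x"]) (auto intro!: derivative_eq_intros)
  ultimately have "has_bochner_integral M (\<lambda>x. of_real (cos (\<phi> x)) + \<i> * of_real (sin (\<phi> x))) (of_real 0 + \<i> * of_real 0)"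
    by (intro has_bochner_integral_add has_bochner_integral_mult_right has_bochner_integral_of_real)
  then show ?thesis
    by (simp add: cis_conv_exp exp_Euler cos_of_real sin_of_real)
qed

section \<open>Moments of the product of estimate and channel at one access point\<close>

text \<open>\<open>A\<close> and \<open>B\<close> may coincide, so their dependence enters only
  through the correlation \<open>C\<close>. Independence of a tuple is expressed through all its
  complex-valued Borel functions \<open>u\<close>, because \<open>indep_var\<close> relates
  variables of one type.\<close>

lemma (in prob_space) contaminated_product_moments:
  fixes A B G W :: "'a \<Rightarrow> complex" and t a b C \<beta> v :: real
  assumes AB_G: "\<And>u. u \<in> borel_measurable borel \<Longrightarrow> indep_var borel (\<lambda>x. u (A x, B x)) borel G"
    and ABG_W: "\<And>u. u \<in> borel_measurable borel \<Longrightarrow> indep_var borel (\<lambda>x. u (A x, B x, G x)) borel W"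
    and A: "\<And>x. cmod (A x) = a" and B: "\<And>x. cmod (B x) = b"
    and AB: "has_bochner_integral M (\<lambda>x. cnj (A x) * B x) (of_real C)"
    and G1: "has_bochner_integral M G 0"
    and G2: "has_bochner_integral M (\<lambda>x. (G x)\<^sup>2) 0"
    and GG: "has_bochner_integral M (\<lambda>x. (cmod (G x))\<^sup>2) \<beta>"
    and GGG: "has_bochner_integral M (\<lambda>x. of_real ((cmod (G x))\<^sup>2) * G x) 0"
    and G4: "has_bochner_integral M (\<lambda>x. cmod (G x) ^ 4) (2 * \<beta>\<^sup>2)"
    and W1: "has_bochner_integral M W 0"
    and WW: "has_bochner_integral M (\<lambda>x. (cmod (W x))\<^sup>2) v"
  shows "has_bochner_integral M (\<lambda>x. cnj (A x + t * G x + W x) * (B x + G x)) (of_real (C + t * \<beta>))"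
    and "has_bochner_integral M (\<lambda>x. (cmod (cnj (A x + t * G x + W x) * (B x + G x)))\<^sup>2)
      ((C + t * \<beta>)\<^sup>2 + (a\<^sup>2 * b\<^sup>2 - C\<^sup>2 + a\<^sup>2 * \<beta> + (t\<^sup>2 * \<beta> + v) * (b\<^sup>2 + \<beta>)))"
proof -
  let ?g = "\<lambda>x. (cmod (G x))\<^sup>2"
  note b = borel_measurable_continuous_onI continuous_intros
  \<comment> \<open>Constant moduli make the functions of \<open>A\<close> and \<open>B\<close> used
    here bounded, hence integrable with no further moment assumptions.\<close>
  have bounded: "has_bochner_integral M (\<lambda>x. u (A x, B x)) (\<integral>x. u (A x, B x) \<partial>M)"
    if "u \<in> borel_measurable borel" "\<And>x. cmod (u (A x, B x)) \<le> K" for u :: "complex \<times> complex \<Rightarrow> complex" and K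
    using that indep_var_rv1[OF AB_G[OF that(1)]]
    by (intro has_bochner_integral_integrable integrable_const_bound[where B=K]) auto
  have mult_G: "has_bochner_integral M (\<lambda>x. u (A x, B x) * g (G x)) (c * d)"
    if "has_bochner_integral M (\<lambda>x. u (A x, B x)) c" "has_bochner_integral M (\<lambda>x. g (G x)) d"
      "u \<in> borel_measurable borel" "g \<in> borel_measurable borel"
    for u :: "complex \<times> complex \<Rightarrow> complex" and g c d
    using indep_var_has_bochner_integral_mult[OF indep_var_apply[OF AB_G[OF that(3)] _ that(4), of "\<lambda>z. z"] that(1,2)]
    by simp
  have null: "has_bochner_integral M (\<lambda>x. u (A x, B x) * g (G x)) 0"
    if "has_bochner_integral M (\<lambda>x. g (G x)) 0" "\<And>x. cmod (u (A x, B x)) \<le> K"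
      "u \<in> borel_measurable borel" "g \<in> borel_measurable borel" for u :: "complex \<times> complex \<Rightarrow> complex" and K g
    using mult_G[OF bounded[OF that(3,2)] that(1,3,4)] by simp
  have mult_W: "has_bochner_integral M (\<lambda>x. u (A x, B x, G x) * g (W x)) (c * d)"
    if "has_bochner_integral M (\<lambda>x. u (A x, B x, G x)) c" "has_bochner_integral M (\<lambda>x. g (W x)) d"
      "u \<in> borel_measurable borel" "g \<in> borel_measurable borel"
    for u :: "complex \<times> complex \<times> complex \<Rightarrow> complex" and g c d
    using indep_var_has_bochner_integral_mult[OF indep_var_apply[OF ABG_W[OF that(3)] _ that(4), of "\<lambda>z. z"] that(1,2)]
    by simp
  have AG: "has_bochner_integral M (\<lambda>x. cnj (A x) * G x) 0"
    using null[of "\<lambda>z. z" "\<lambda>z. cnj (fst z)" a] G1 A by (simp add: b)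
  have BG: "has_bochner_integral M (\<lambda>x. cnj (B x) * G x) 0"
    using null[of "\<lambda>z. z" "\<lambda>z. cnj (snd z)" b] G1 B by (simp add: b)
  have AGGG: "has_bochner_integral M (\<lambda>x. cnj (A x) * (of_real ((cmod (G x))\<^sup>2) * G x)) 0"
    using null[of "\<lambda>z. of_real ((cmod z)\<^sup>2) * z" "\<lambda>z. cnj (fst z)" a] GGG A by (simp add: b)
  have BGGG: "has_bochner_integral M (\<lambda>x. cnj (B x) * (of_real ((cmod (G x))\<^sup>2) * G x)) 0"
    using null[of "\<lambda>z. of_real ((cmod z)\<^sup>2) * z" "\<lambda>z. cnj (snd z)" b] GGG B by (simp add: b)
  have ABG2: "has_bochner_integral M (\<lambda>x. cnj (A x) * cnj (B x) * (G x)\<^sup>2) 0"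
    using null[of "\<lambda>z. z\<^sup>2" "\<lambda>z. cnj (fst z) * cnj (snd z)" "a * b"] G2 A B by (simp add: b norm_mult)
  have ABGG: "has_bochner_integral M (\<lambda>x. cnj (A x) * B x * of_real ((cmod (G x))\<^sup>2)) (of_real C * of_real \<beta>)"
    using mult_G[of "\<lambda>z. cnj (fst z) * snd z" _ "\<lambda>z. of_real ((cmod z)\<^sup>2)"] AB
      has_bochner_integral_of_real[where 'a=complex, OF GG] by (simp add: b)
  have BcG: "has_bochner_integral M (\<lambda>x. B x * cnj (G x)) 0"
    using has_bochner_integral_cnj[OF BG] by simp

  \<comment> \<open>The mean of \<open>B\<close> can stay unevaluated: it is about to be multiplied
    by the zero mean of \<open>W\<close>.\<close>
  have "has_bochner_integral M (\<lambda>x. B x + G x) ((\<integral>x. B x \<partial>M) + 0)"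
    using bounded[of snd b] B G1 by (intro has_bochner_integral_add) (simp_all add: b)
  then have "has_bochner_integral M (\<lambda>x. cnj (W x) * (B x + G x)) 0"
    using mult_W[of "\<lambda>z. fst (snd z) + snd (snd z)" _ cnj 0] has_bochner_integral_cnj[OF W1]
    by (simp add: b mult.commute)
  from has_bochner_integral_add[OF AB has_bochner_integral_add[OF AG has_bochner_integral_add[OF
        has_bochner_integral_mult_right[where c="of_real t", OF BcG] has_bochner_integral_add[OF
        has_bochner_integral_mult_right[where c="of_real t", OF has_bochner_integral_of_real[where 'a=complex, OF GG]] this]]]]
  show "has_bochner_integral M (\<lambda>x. cnj (A x + t * G x + W x) * (B x + G x)) (of_real (C + t * \<beta>))"
    by (simp add: algebra_simps complex_norm_square del: of_real_power)

  have const: "has_bochner_integral M (\<lambda>x. c) c" for c :: real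
    by (simp add: has_bochner_integral_iff prob_space)
  have "has_bochner_integral M (\<lambda>x. b\<^sup>2 + (?g x + 2 * Re (cnj (B x) * G x))) (b\<^sup>2 + (\<beta> + 2 * Re 0))"
    by (intro has_bochner_integral_add has_bochner_integral_mult_right has_bochner_integral_Re const GG BG)
  moreover have "(cmod (B x + G x))\<^sup>2 = b\<^sup>2 + (?g x + 2 * Re (cnj (B x) * G x))" for x
    unfolding B[of x, symmetric] cmod_power2 by (simp add: power2_eq_square algebra_simps)
  ultimately have Z: "has_bochner_integral M (\<lambda>x. (cmod (B x + G x))\<^sup>2) (b\<^sup>2 + \<beta>)"
    by simp
  \<comment> \<open>Full expansion of \<open>|A + t G|^2 |B + G|^2\<close>. The last two terms come
    from the product of the two cross terms by \<open>2 Re p Re q = Re (p q) + Re (p cnj q)\<close>.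
    Besides the constant, only \<open>|G|^2\<close>, \<open>|G|^4\<close> and the term with
    \<open>cnj A * B\<close> have nonzero mean.\<close>
  have "has_bochner_integral M
    (\<lambda>x. a\<^sup>2 * b\<^sup>2 + ((a\<^sup>2 + t\<^sup>2 * b\<^sup>2) * ?g x + (t\<^sup>2 * cmod (G x) ^ 4 + (2 * a\<^sup>2 * Re (cnj (B x) * G x)
      + (2 * t * b\<^sup>2 * Re (cnj (A x) * G x)
      + (2 * t * Re (cnj (A x) * (of_real (?g x) * G x)) + (2 * t\<^sup>2 * Re (cnj (B x) * (of_real (?g x) * G x))
      + (2 * t * Re (cnj (A x) * cnj (B x) * (G x)\<^sup>2) + 2 * t * Re (cnj (A x) * B x * of_real (?g x))))))))))
    (a\<^sup>2 * b\<^sup>2 + ((a\<^sup>2 + t\<^sup>2 * b\<^sup>2) * \<beta> + (t\<^sup>2 * (2 * \<beta>\<^sup>2) + (2 * a\<^sup>2 * Re 0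
      + (2 * t * b\<^sup>2 * Re 0 + (2 * t * Re 0 + (2 * t\<^sup>2 * Re 0
      + (2 * t * Re 0 + 2 * t * Re (of_real C * of_real \<beta>)))))))))" (is "has_bochner_integral M ?f _")
    by (intro has_bochner_integral_add has_bochner_integral_mult_right has_bochner_integral_Re const
        GG G4 BG AG AGGG BGGG ABG2 ABGG)
  then have YZ: "has_bochner_integral M (\<lambda>x. (cmod (A x + t * G x))\<^sup>2 * (cmod (B x + G x))\<^sup>2)
      (a\<^sup>2 * b\<^sup>2 + (a\<^sup>2 + t\<^sup>2 * b\<^sup>2) * \<beta> + 2 * t\<^sup>2 * \<beta>\<^sup>2 + 2 * t * C * \<beta>)"
  proof (rule has_bochner_integral_eqI)
    fix x
    have "cmod (G x) ^ 4 = ((cmod (G x))\<^sup>2)\<^sup>2" by simp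
    then show "?f x = (cmod (A x + t * G x))\<^sup>2 * (cmod (B x + G x))\<^sup>2"
      unfolding A[of x, symmetric] B[of x, symmetric] cmod_power2
      by (simp add: power2_eq_square algebra_simps del: of_real_add of_real_mult)
  qed simp
  \<comment> \<open>\<open>mult_W\<close> is about complex variables, so the real factors are
    embedded first and the real part is taken afterwards.\<close>
  have ZW: "has_bochner_integral M (\<lambda>x. (cmod (B x + G x))\<^sup>2 * (cmod (W x))\<^sup>2) ((b\<^sup>2 + \<beta>) * v)"
  proof -
    have "has_bochner_integral M (\<lambda>x. complex_of_real ((cmod (B x + G x))\<^sup>2) * complex_of_real ((cmod (W x))\<^sup>2))
        (of_real (b\<^sup>2 + \<beta>) * of_real v)"
      using mult_W[of "\<lambda>z. of_real ((cmod (fst (snd z) + snd (snd z)))\<^sup>2)" "of_real (b\<^sup>2 + \<beta>)"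
          "\<lambda>z. of_real ((cmod z)\<^sup>2)" "of_real v"]
        has_bochner_integral_of_real[where 'a=complex, OF Z] has_bochner_integral_of_real[where 'a=complex, OF WW]
      by (simp add: b del: of_real_power of_real_add)
    from has_bochner_integral_Re[OF this] show ?thesis
      by (simp add: of_real_mult[symmetric] del: of_real_mult of_real_power of_real_add)
  qed
  \<comment> \<open>Only integrability of this factor matters, since \<open>W\<close> has mean zero.
    The bound \<open>y \<le> 1 + y^2\<close> dominates it by two terms already known to be
    integrable.\<close>
  have "integrable M (\<lambda>x. cnj (A x + t * G x) * of_real ((cmod (B x + G x))\<^sup>2))"
  proof (rule Bochner_Integration.integrable_bound)
    show "integrable M (\<lambda>x. (cmod (B x + G x))\<^sup>2 + (cmod (A x + t * G x))\<^sup>2 * (cmod (B x + G x))\<^sup>2)"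
      using Z YZ by (auto simp: has_bochner_integral_iff)
    show "(\<lambda>x. cnj (A x + t * G x) * of_real ((cmod (B x + G x))\<^sup>2)) \<in> borel_measurable M"
      using indep_var_rv1[OF ABG_W[of "\<lambda>z. cnj (fst z + t * snd (snd z)) * of_real ((cmod (fst (snd z) + snd (snd z)))\<^sup>2)"]]
      by (simp add: b)
    have "y * z \<le> z + y\<^sup>2 * z" if "0 \<le> z" for y z :: real
    proof -
      have "y \<le> 1 + y\<^sup>2" using zero_le_power2[of "y - 1/2"]
        by (simp add: power2_eq_square algebra_simps)
      from mult_right_mono[OF this that] show ?thesis by (simp add: algebra_simps)
    qed
    then show "AE x in M. norm (cnj (A x + t * G x) * of_real ((cmod (B x + G x))\<^sup>2))
        \<le> norm ((cmod (B x + G x))\<^sup>2 + (cmod (A x + t * G x))\<^sup>2 * (cmod (B x + G x))\<^sup>2)"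
      by (simp add: norm_mult norm_power del: complex_cnj_add complex_cnj_mult)
  qed
  then have YZW: "has_bochner_integral M (\<lambda>x. cnj (A x + t * G x) * of_real ((cmod (B x + G x))\<^sup>2) * W x) 0"
    using mult_W[of "\<lambda>z. cnj (fst z + t * snd (snd z)) * of_real ((cmod (fst (snd z) + snd (snd z)))\<^sup>2)" _ "\<lambda>z. z" 0]
      has_bochner_integral_integrable W1
    by (fastforce simp add: b)
  have expand: "(cmod y)\<^sup>2 * (cmod z)\<^sup>2 + ((cmod z)\<^sup>2 * (cmod w)\<^sup>2
      + 2 * Re (cnj y * of_real ((cmod z)\<^sup>2) * w)) = (cmod (cnj (y + w) * z))\<^sup>2" for y z w
    unfolding norm_mult power_mult_distrib complex_mod_cnj cmod_power2
    by (simp add: power2_eq_square algebra_simps del: of_real_add of_real_mult)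
  \<comment> \<open>The fourth moment contributes \<open>2 * t^2 * \<beta>^2\<close>: one copy
    completes the square \<open>(C + t * \<beta>)^2\<close>, the other completes the product with
    \<open>b^2 + \<beta>\<close>.\<close>
  show "has_bochner_integral M (\<lambda>x. (cmod (cnj (A x + t * G x + W x) * (B x + G x)))\<^sup>2)
      ((C + t * \<beta>)\<^sup>2 + (a\<^sup>2 * b\<^sup>2 - C\<^sup>2 + a\<^sup>2 * \<beta> + (t\<^sup>2 * \<beta> + v) * (b\<^sup>2 + \<beta>)))"
    by (rule has_bochner_integral_eqI[OF has_bochner_integral_add[OF YZ has_bochner_integral_add[OF ZW
        has_bochner_integral_mult_right[where c=2, OF has_bochner_integral_Re[OF YZW]]]] expand])
      (simp add: power2_eq_square algebra_simps)
qed

lemma (in prob_space) indep_vars_imp_indep_var: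
  assumes "indep_vars (\<lambda>_. borel) V K" "i \<in> K" "j \<in> K" "i \<noteq> j"
  shows "indep_var borel (V i) borel (V j)"
  using indep_var_blocks[OF assms(1), of "{i}" "{j}" "\<lambda>v. v i" "\<lambda>v. v j"] assms(2-4)
  by simp

section \<open>Algebra of diagonal matrices\<close>

lemma diag_mult: "diag u ** diag v = diag (\<chi> i. u $ i * v $ i)"
proof -
  have "(\<Sum>k\<in>UNIV. (if i = k then u $ i else 0) * (if k = j then v $ k else 0))
      = (\<Sum>k\<in>UNIV. if k = i then (if i = j then u $ i * v $ i else 0) else 0)" for i j
    by (rule sum.cong) auto
  then show ?thesis by (simp add: diag_def matrix_matrix_mult_def vec_eq_iff)
qed

lemma trace_diag: "trace (diag u) = (\<Sum>i\<in>UNIV. u $ i)"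
  by (simp add: trace_def diag_def)

lemma diag_add: "diag u + diag v = diag (\<chi> i. u $ i + v $ i)"
  by (simp add: diag_def vec_eq_iff)

lemma scaleR_diag: "c *\<^sub>R diag u = diag (\<chi> i. c * u $ i)"
  by (simp add: diag_def vec_eq_iff)

lemma diag_sqrt_diag: "diag_sqrt (diag u) = diag (\<chi> i. sqrt (u $ i))"
  by (simp add: diag_sqrt_def diag_def)

text \<open>Since \<open>matrix_inv\<close> is a Hilbert choice, exhibiting a two-sided inverse is
  not enough; uniqueness of inverses identifies the chosen one.\<close>

lemma matrix_inv_diag:
  assumes "\<And>i. u $ i \<noteq> 0"
  shows "matrix_inv (diag u) = diag (\<chi> i. 1 / u $ i)"
proof -
  have "diag u ** diag (\<chi> i. 1 / u $ i) = mat 1"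
    using assms by (simp add: diag_mult) (simp add: diag_def mat_def vec_eq_iff)
  then have *: "diag u ** diag (\<chi> i. 1 / u $ i) = mat 1 \<and> diag (\<chi> i. 1 / u $ i) ** diag u = mat 1"
    by (simp add: matrix_left_right_inverse)
  show ?thesis
    unfolding matrix_inv_def
    by (rule some_equality, rule *) (metis * matrix_mul_assoc matrix_mul_lid matrix_mul_rid)
qed

text \<open>Singles out the share of user \<open>k\<close> in a pilot sum without first deciding
  whether \<open>k\<close> uses that pilot.\<close>

lemma sum_split_at:
  "finite I \<Longrightarrow> sum f I = (if k \<in> I then f k else 0) + sum f (I - {k})"
  by (cases "k \<in> I") (simp_all add: sum.remove)

section \<open>The sources of randomness as one independent complex family\<close>

context cell_free_model
begin

sublocale prob_space "prob_sp S"
  by (rule prob_space_prob_sp)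

text \<open>Gives all sources the common type \<open>complex\<close>: phases enter only through
  \<open>cis\<close>, and noise only after correlation with a pilot. The parameter \<open>l\<close>
  is the user whose pilot is correlated.\<close>

definition source_var :: "'k \<Rightarrow> ('m, 'k) source \<Rightarrow> 'w \<Rightarrow> complex" where
  "source_var l i = (case i of
      Phase m k \<Rightarrow> \<lambda>x. cis (phase S m k x)
    | Scatter m k \<Rightarrow> scatter S m k
    | Noise m \<Rightarrow> \<lambda>x. herm_inner (pilot_seq S (pilot_index S l)) (pilot_noise S m x))"

lemma complex_normal_measurable: "complex_normal (prob_sp S) X v \<Longrightarrow> X \<in> borel_measurable (prob_sp S)"
  by (auto simp: complex_normal_def borel_measurable_complex_iff dest!: distributed_measurable)

lemma borel_measurable_cnj_complex: "cnj \<in> borel_measurable borel"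
  by (intro borel_measurable_continuous_onI continuous_intros)

lemma source_var_measurable: "source_var l i \<in> borel_measurable (prob_sp S)"
proof (cases i)
  case (Phase m k)
  have "phase S m k \<in> borel_measurable (prob_sp S)"
    using distributed_measurable[OF phase_uniform[of m k]] by simp
  then have "(\<lambda>x. cis (phase S m k x)) \<in> borel_measurable (prob_sp S)"
    by (rule measurable_compose) (intro borel_measurable_continuous_onI continuous_intros)
  then show ?thesis using Phase by (simp add: source_var_def)
next
  case (Scatter m k)
  then show ?thesis
    using complex_normal_measurable[OF scatter_normal[of m k]] by (simp add: source_var_def)
next
  case (Noise m)
  have [measurable]: "(\<lambda>x. pilot_noise S m x $ i) \<in> borel_measurable (prob_sp S)" for i
    using pilot_noise_normal[of m] complex_normal_measurable by (auto simp: complex_normal_vec_def)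
  show ?thesis
    using Noise by (simp add: source_var_def herm_inner_def)
qed

text \<open>Each member is a Borel function of the raw source, so its events form a subfamily of
  \<open>source_events\<close>, and independence passes to subfamilies.\<close>

lemma indep_source_var: "indep_vars (\<lambda>_. borel) (source_var l) UNIV"
  unfolding indep_vars_def2
proof (intro conjI ballI source_var_measurable indep_sets_mono_sets[OF sources_indep])
  have sub: "{(\<lambda>x. f (X x)) -` A \<inter> space (prob_sp S) | A. A \<in> sets borel} \<subseteq> generated_events (prob_sp S) X"
    if f: "f \<in> borel_measurable borel"
    for f :: "'b::topological_space \<Rightarrow> complex" and X :: "'w \<Rightarrow> 'b"
  proof safe
    fix A :: "complex set" assume "A \<in> sets borel"
    then have "f -` A \<in> sets borel" using measurable_sets[OF f] by simp
    moreover have "(\<lambda>x. f (X x)) -` A = X -` (f -` A)" by auto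
    ultimately show "(\<lambda>x. f (X x)) -` A \<inter> space (prob_sp S) \<in> generated_events (prob_sp S) X"
      unfolding generated_events_def by blast
  qed
  have "cis \<in> borel_measurable borel" "herm_inner u \<in> borel_measurable borel" for u :: "complex ^ 't"
    unfolding herm_inner_def by (intro borel_measurable_continuous_onI continuous_intros)+
  then show "{source_var l i -` A \<inter> space (prob_sp S) | A. A \<in> sets borel} \<subseteq> source_events S i" for i
    using sub[of cis "phase S _ _"] sub[of "\<lambda>z. z" "scatter S _ _"] sub[of "herm_inner _" "pilot_noise S _"]
    by (cases i) (simp_all add: source_var_def)
qed

lemma lam_pos: "0 < lam S m l"
  using pilot_pow_pos beta_pos ul_noise_var_pos
  unfolding lam_def pilot_len_def by (intro add_nonneg_pos sum_nonneg) (auto intro: less_imp_le)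

text \<open>Noise entries are independent, so their variances add with weights
  \<open>|u_i|^2\<close>, and the squared pilot norm is the pilot length.\<close>

lemma pilot_noise_moments:
  "has_bochner_integral (prob_sp S) (source_var l (Noise m)) 0"
  "has_bochner_integral (prob_sp S) (\<lambda>x. (cmod (source_var l (Noise m) x))\<^sup>2) (pilot_len S * ul_noise_var S)"
proof -
  let ?u = "pilot_seq S (pilot_index S l)"
  have normal: "complex_normal (prob_sp S) (\<lambda>x. pilot_noise S m x $ i) (ul_noise_var S)" for i
    using pilot_noise_normal[of m] by (auto simp: complex_normal_vec_def)
  have indep: "indep_vars (\<lambda>_. borel) (\<lambda>i x. pilot_noise S m x $ i) UNIV"
    using pilot_noise_normal[of m] by (auto simp: complex_normal_vec_def)
  note moments = complex_normal_moments[OF ul_noise_var_pos normal]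
  have "has_bochner_integral (prob_sp S) (\<lambda>x. \<Sum>i\<in>UNIV. cnj (?u $ i) * pilot_noise S m x $ i) (\<Sum>i\<in>UNIV. cnj (?u $ i) * 0)"
    by (intro has_bochner_integral_sum has_bochner_integral_mult_right moments)
  then show "has_bochner_integral (prob_sp S) (source_var l (Noise m)) 0"
    by (simp add: source_var_def herm_inner_def)
  have "(\<Sum>i\<in>UNIV. (cmod (?u $ i))\<^sup>2) = pilot_len S"
    using pilot_norm[of "pilot_index S l"]
    by (simp add: norm_vec_def L2_set_def pilot_len_def sum_nonneg)
  then show "has_bochner_integral (prob_sp S) (\<lambda>x. (cmod (source_var l (Noise m) x))\<^sup>2) (pilot_len S * ul_noise_var S)"
    using second_moment_sum[where I=UNIV and c="\<lambda>i. cnj (?u $ i)", OF finite moments(1,3) indep_vars_imp_indep_var[OF indep]]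
    by (simp add: source_var_def herm_inner_def sum_distrib_right[symmetric])
qed

lemmas scatter_moments = complex_normal_moments[OF beta_pos scatter_normal]

section \<open>Estimate and channel in terms of the sources\<close>

definition est_gain :: "'m \<Rightarrow> 'k \<Rightarrow> real" where
  "est_gain m l = sqrt (pilot_pow S l) * beta S m l / lam S m l"

definition pilot_amp :: "'k \<Rightarrow> real" where
  "pilot_amp i = sqrt (pilot_pow S i) * pilot_len S"

text \<open>Subtracting \<open>pilot_obs_mean\<close> cancels the line-of-sight parts of all users
  on the pilot, leaving scattered components and noise.\<close>

lemma mmse_est_source_var:
  "mmse_est S l x $ m = of_real (hbar S m l) * source_var l (Phase m l) x
    + of_real (est_gain m l) * ((\<Sum>i\<in>copilot S l. of_real (pilot_amp i) * source_var l (Scatter m i) x)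
      + source_var l (Noise m) x)"
proof -
  have "pilot_obs S m l x - pilot_obs_mean S m l x
      = (\<Sum>i\<in>copilot S l. of_real (pilot_amp i) * scatter S m i x)
        + herm_inner (pilot_seq S (pilot_index S l)) (pilot_noise S m x)"
    unfolding pilot_obs_def pilot_obs_mean_def
    by (simp add: chan_def pilot_amp_def algebra_simps sum.distrib)
  then show ?thesis
    by (simp add: mmse_est_def source_var_def est_gain_def)
qed

text \<open>Only the noise members depend on \<open>l\<close>, so the channel can be written in the
  family belonging to any estimated user.\<close>

lemma chan_source_var:
  "chan S k x $ m = of_real (hbar S m k) * source_var l (Phase m k) x + source_var l (Scatter m k) x"
  by (simp add: chan_def source_var_def)

text \<open>The variance of the estimated scattered component, that is, a diagonal entry of
  \<open>pilot_pow S l * pilot_len S\<close> times \<open>Ommat S l\<close>.\<close>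

definition est_var :: "'m \<Rightarrow> 'k \<Rightarrow> real" where
  "est_var m l = pilot_pow S l * pilot_len S * (beta S m l)\<^sup>2 / lam S m l"

text \<open>The first summand is the line-of-sight correlation. The second comes from the scattered
  component of user \<open>k\<close> inside the estimate for \<open>l\<close>: pilot contamination
  if \<open>l\<close> and \<open>k\<close> differ.\<close>

definition mr_mean :: "'m \<Rightarrow> 'k \<Rightarrow> 'k \<Rightarrow> real" where
  "mr_mean m l k = (if l = k then (hbar S m l)\<^sup>2 else 0)
    + (if k \<in> copilot S l then est_gain m l * pilot_amp k * beta S m k else 0)"

text \<open>For one user the phase cancels; for two users the phases are independent with mean-zero
  exponentials.\<close>

lemma los_correlation:
  "has_bochner_integral (prob_sp S)
     (\<lambda>x. cnj (of_real (hbar S m l) * source_var l (Phase m l) x) * (of_real (hbar S m k) * source_var l (Phase m k) x))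
     (of_real (if l = k then (hbar S m l)\<^sup>2 else 0))"
proof (cases "l = k")
  case True
  have "cnj (of_real (hbar S m l) * source_var l (Phase m l) x) * (of_real (hbar S m k) * source_var l (Phase m k) x)
      = of_real ((hbar S m l)\<^sup>2)" for x
    using True by (simp add: source_var_def power2_eq_square cis_cnj cis_mult mult_ac flip: cis_inverse)
  then show ?thesis
    using True by (simp add: has_bochner_integral_iff prob_space del: of_real_power)
next
  case False
  have mean: "has_bochner_integral (prob_sp S) (source_var l (Phase m i)) 0" for i
    using uniform_phase_expectation[OF phase_uniform] by (simp add: source_var_def)
  have "indep_var borel (source_var l (Phase m l)) borel (source_var l (Phase m k))"
    using False by (intro indep_vars_imp_indep_var[OF indep_source_var]) auto
  then have "indep_var borel (\<lambda>x. cnj (source_var l (Phase m l) x)) borel (source_var l (Phase m k))"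
    using indep_var_apply[of _ _ cnj "\<lambda>z. z"] borel_measurable_cnj_complex by fastforce
  from has_bochner_integral_mult_right[where c="of_real (hbar S m l * hbar S m k)",
      OF indep_var_has_bochner_integral_mult[OF this has_bochner_integral_cnj[OF mean] mean]]
  show ?thesis using False by (simp add: mult_ac)
qed

lemma ap_moments:
  shows "has_bochner_integral (prob_sp S) (\<lambda>x. cnj (mmse_est S l x $ m) * chan S k x $ m) (of_real (mr_mean m l k))"
    and "has_bochner_integral (prob_sp S) (\<lambda>x. (cmod (cnj (mmse_est S l x $ m) * chan S k x $ m))\<^sup>2)
      ((mr_mean m l k)\<^sup>2 + ((if l = k then 0 else (hbar S m l)\<^sup>2 * (hbar S m k)\<^sup>2) + (hbar S m l)\<^sup>2 * beta S m k
        + est_var m l * ((hbar S m k)\<^sup>2 + beta S m k)))"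
proof -
  let ?V = "source_var l"
  \<comment> \<open>The estimate is split as \<open>A + t G + W\<close> with
    \<open>G = scatter S m k\<close>: \<open>t\<close> is 0 when the pilots differ, \<open>J\<close>
    indexes the sources in \<open>W\<close>, \<open>\<kappa>\<close> gives their weights and
    \<open>s\<close> their variances.\<close>
  define A where "A x = of_real (hbar S m l) * ?V (Phase m l) x" for x
  define B where "B x = of_real (hbar S m k) * ?V (Phase m k) x" for x
  define t where "t = (if k \<in> copilot S l then est_gain m l * pilot_amp k else 0)"
  define J where "J = insert (Noise m) (Scatter m ` (copilot S l - {k}))"
  define \<kappa> where "\<kappa> j = est_gain m l * (case j of Scatter _ i \<Rightarrow> pilot_amp i | _ \<Rightarrow> 1)" for j :: "('m, 'k) source"
  define W where "W x = (\<Sum>j\<in>J. of_real (\<kappa> j) * ?V j x)" for x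
  define s where "s j = (case j of Scatter _ i \<Rightarrow> beta S m i | _ \<Rightarrow> pilot_len S * ul_noise_var S)"
    for j :: "('m, 'k) source"
  define v where "v = (\<Sum>j\<in>J. (\<kappa> j)\<^sup>2 * s j)"
  have sumJ: "(\<Sum>j\<in>J. f j) = f (Noise m) + (\<Sum>i\<in>copilot S l - {k}. f (Scatter m i))"
    for f :: "('m, 'k) source \<Rightarrow> 'a::comm_monoid_add"
    unfolding J_def by (subst sum.insert) (auto simp: sum.reindex inj_on_def)
  have est: "mmse_est S l x $ m = A x + of_real t * scatter S m k x + W x" for x
  proof -
    have "(\<Sum>i\<in>copilot S l. of_real (pilot_amp i) * source_var l (Scatter m i) x)
        = (if k \<in> copilot S l then of_real (pilot_amp k) * scatter S m k x else 0)
          + (\<Sum>i\<in>copilot S l - {k}. of_real (pilot_amp i) * source_var l (Scatter m i) x)"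
      by (subst sum_split_at[where k=k]) (simp_all add: source_var_def)
    then show ?thesis
      unfolding mmse_est_source_var A_def W_def sumJ
      by (simp add: \<kappa>_def t_def algebra_simps sum_distrib_left)
  qed
  have chan: "chan S k x $ m = B x + scatter S m k x" for x
    by (simp add: chan_source_var[of _ _ _ l] B_def) (simp add: source_var_def)
  \<comment> \<open>Whether or not \<open>k\<close> shares the pilot, the two parts recombine to the
    sum defining \<open>lam\<close>, giving \<open>est_gain^2 * pilot_len * lam\<close>; one factor
    \<open>lam\<close> then cancels.\<close>
  have v: "t\<^sup>2 * beta S m k + v = est_var m l"
  proof -
    have amp: "(pilot_amp i)\<^sup>2 = pilot_pow S i * (pilot_len S)\<^sup>2" for i
      using less_imp_le[OF pilot_pow_pos[of i]] by (simp add: pilot_amp_def power_mult_distrib)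
    have "(\<Sum>i\<in>copilot S l. (est_gain m l)\<^sup>2 * (pilot_amp i)\<^sup>2 * beta S m i)
        = t\<^sup>2 * beta S m k + (\<Sum>i\<in>copilot S l - {k}. (est_gain m l)\<^sup>2 * (pilot_amp i)\<^sup>2 * beta S m i)"
      by (subst sum_split_at[where k=k]) (simp_all add: t_def power_mult_distrib)
    moreover have "(\<Sum>i\<in>copilot S l. (est_gain m l)\<^sup>2 * (pilot_amp i)\<^sup>2 * beta S m i)
        = (est_gain m l)\<^sup>2 * pilot_len S * (\<Sum>i\<in>copilot S l. pilot_pow S i * pilot_len S * beta S m i)"
      unfolding sum_distrib_left amp by (rule sum.cong) (simp_all add: power2_eq_square)
    moreover have "v = (est_gain m l)\<^sup>2 * (pilot_len S * ul_noise_var S)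
        + (\<Sum>i\<in>copilot S l - {k}. (est_gain m l)\<^sup>2 * (pilot_amp i)\<^sup>2 * beta S m i)"
      unfolding v_def sumJ by (simp add: \<kappa>_def s_def power_mult_distrib)
    ultimately have "t\<^sup>2 * beta S m k + v = (est_gain m l)\<^sup>2 * pilot_len S * lam S m l"
      by (simp add: lam_def algebra_simps)
    then show ?thesis
      using lam_pos[of m l] less_imp_le[OF pilot_pow_pos[of l]]
      by (simp add: est_gain_def est_var_def power_mult_distrib power_divide) (simp add: power2_eq_square)
  qed
  have W1: "has_bochner_integral (prob_sp S) (?V j) 0" and W2: "has_bochner_integral (prob_sp S) (\<lambda>x. (cmod (?V j x))\<^sup>2) (s j)"
    if "j \<in> J" for j
    using that pilot_noise_moments[of l m] scatter_moments(1,3)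
    by (auto simp: J_def s_def source_var_def)
  have "has_bochner_integral (prob_sp S) W (\<Sum>j\<in>J. of_real (\<kappa> j) * 0)"
    unfolding W_def by (intro has_bochner_integral_sum has_bochner_integral_mult_right W1)
  then have W_mean: "has_bochner_integral (prob_sp S) W 0" by simp
  have W_second: "has_bochner_integral (prob_sp S) (\<lambda>x. (cmod (W x))\<^sup>2) v"
    using second_moment_sum[where I=J and c="\<lambda>j. of_real (\<kappa> j)", OF _ W1 W2 indep_vars_imp_indep_var[OF indep_source_var]]
    by (simp add: W_def v_def J_def)
  have AB_G: "indep_var borel (\<lambda>x. u (A x, B x)) borel (scatter S m k)" if u: "u \<in> borel_measurable borel" for u
  proof -
    let ?I = "{Phase m l, Phase m k} :: ('m, 'k) source set"
    have "(\<lambda>v. u (of_real (hbar S m l) * v (Phase m l), of_real (hbar S m k) * v (Phase m k)))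
        \<in> borel_measurable (PiM ?I (\<lambda>_. borel))"
      by (intro measurable_compose[OF _ u] borel_measurable_Pair borel_measurable_times
          borel_measurable_const measurable_component_singleton) auto
    from indep_var_blocks[OF indep_source_var, where J="{Scatter m k}" and g="\<lambda>v. v (Scatter m k)", OF _ _ _ this, of l]
    show ?thesis
      unfolding A_def B_def by (simp add: source_var_def[of _ "Scatter _ _"])
  qed
  have ABG_W: "indep_var borel (\<lambda>x. u (A x, B x, scatter S m k x)) borel W" if u: "u \<in> borel_measurable borel" for u
  proof -
    let ?I = "{Phase m l, Phase m k, Scatter m k} :: ('m, 'k) source set"
    have 1: "(\<lambda>v. u (of_real (hbar S m l) * v (Phase m l), of_real (hbar S m k) * v (Phase m k), v (Scatter m k)))
        \<in> borel_measurable (PiM ?I (\<lambda>_. borel))"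
      by (intro measurable_compose[OF _ u] borel_measurable_Pair borel_measurable_times
          borel_measurable_const measurable_component_singleton) auto
    have 2: "(\<lambda>v. \<Sum>j\<in>J. of_real (\<kappa> j) * v j :: complex) \<in> borel_measurable (PiM J (\<lambda>_. borel))"
      by (intro borel_measurable_sum borel_measurable_times
          borel_measurable_const measurable_component_singleton) auto
    \<comment> \<open>Disjointness holds because user \<open>k\<close> was removed from
      \<open>J\<close>.\<close>
    have "?I \<inter> J = {}" by (auto simp: J_def)
    from indep_var_blocks[OF indep_source_var this _ _ 1 _ 2, of l]
    show ?thesis
      unfolding A_def B_def W_def by (simp add: source_var_def[of _ "Scatter _ _"])
  qed
  have mean: "(if l = k then (hbar S m l)\<^sup>2 else 0) + t * beta S m k = mr_mean m l k"
    by (auto simp: mr_mean_def t_def)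
  have "cmod (A x) = hbar S m l" "cmod (B x) = hbar S m k" for x
    using hbar_nonneg by (simp_all add: A_def B_def norm_mult source_var_def)
  note moments = contaminated_product_moments[OF AB_G ABG_W this los_correlation[of m l k, folded A_def B_def] scatter_moments W_mean W_second,
      of t, folded est chan]
  show "has_bochner_integral (prob_sp S) (\<lambda>x. cnj (mmse_est S l x $ m) * chan S k x $ m) (of_real (mr_mean m l k))"
    using moments(1) unfolding mean .
  \<comment> \<open>The term \<open>a^2 * b^2 - C^2\<close> vanishes for \<open>l = k\<close>, where
    \<open>C = a^2 = b^2\<close>, and equals \<open>a^2 * b^2\<close> otherwise. This is the origin
    of \<open>Smat\<close>.\<close>
  show "has_bochner_integral (prob_sp S) (\<lambda>x. (cmod (cnj (mmse_est S l x $ m) * chan S k x $ m))\<^sup>2)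
      ((mr_mean m l k)\<^sup>2 + ((if l = k then 0 else (hbar S m l)\<^sup>2 * (hbar S m k)\<^sup>2) + (hbar S m l)\<^sup>2 * beta S m k
        + est_var m l * ((hbar S m k)\<^sup>2 + beta S m k)))"
    by (rule has_bochner_integral_eqI[OF moments(2) refl], unfold mean v) (auto simp: power2_eq_square)
qed

text \<open>Both products are functions of the sources at their own access point, and these index
  blocks are disjoint.\<close>

lemma indep_aps:
  assumes "m \<noteq> m'"
  shows "indep_var borel (\<lambda>x. cnj (mmse_est S l x $ m) * chan S k x $ m)
      borel (\<lambda>x. cnj (mmse_est S l x $ m') * chan S k x $ m')"
proof -
  let ?I = "\<lambda>m. insert (Noise m) (range (Phase m) \<union> range (Scatter m)) :: ('m, 'k) source set"
  let ?f = "\<lambda>m v. cnj (of_real (hbar S m l) * v (Phase m l)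
        + of_real (est_gain m l) * ((\<Sum>i\<in>copilot S l. of_real (pilot_amp i) * v (Scatter m i)) + v (Noise m)))
      * (of_real (hbar S m k) * v (Phase m k) + v (Scatter m k))"
  have f: "?f m \<in> borel_measurable (PiM (?I m) (\<lambda>_. borel))" for m
    by (intro borel_measurable_times borel_measurable_add borel_measurable_sum borel_measurable_const
        measurable_compose[OF _ borel_measurable_cnj_complex] measurable_component_singleton) auto
  have "?I m \<inter> ?I m' = {}" using assms by auto
  from indep_var_blocks[OF indep_source_var this _ _ f _ f, of l]
  show ?thesis by (simp add: mmse_est_source_var chan_source_var[of _ _ _ l])
qed

section \<open>Summation over the access points\<close>

definition mr_pow :: "'m \<Rightarrow> 'k \<Rightarrow> real" where
  "mr_pow m l = dl_pow S m l / (\<integral>x. (cmod (mmse_est S l x $ m))\<^sup>2 \<partial>prob_sp S)"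

lemma mr_pow_nonneg: "0 \<le> mr_pow m l"
  by (simp add: mr_pow_def dl_pow_nonneg)

lemma diag_forms:
  "Dmat S l = diag (\<chi> m. mr_pow m l)"
  "Lammat S l = diag (\<chi> m. 1 / lam S m l)"
  "Ommat S l = diag (\<chi> m. (beta S m l)\<^sup>2 / lam S m l)"
  "Zmat S l = diag (\<chi> m. est_var m l + (hbar S m l)\<^sup>2)"
proof -
  show "Dmat S l = diag (\<chi> m. mr_pow m l)"
    by (simp add: Dmat_def mr_pow_def)
  show Lam: "Lammat S l = diag (\<chi> m. 1 / lam S m l)"
    using lam_pos by (simp add: Lammat_def matrix_inv_diag less_imp_neq[symmetric])
  then show "Ommat S l = diag (\<chi> m. (beta S m l)\<^sup>2 / lam S m l)"
    by (simp add: Ommat_def Rmat_def diag_mult power2_eq_square)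
  then show "Zmat S l = diag (\<chi> m. est_var m l + (hbar S m l)\<^sup>2)"
    by (simp add: Zmat_def Lmat_def scaleR_diag diag_add est_var_def)
qed

text \<open>Passing from second moments to variances removes the squared \<open>mr_mean\<close> of
  each access point; what returns is the square of the total mean.\<close>

lemma mr_product_moments:
  assumes w: "\<And>k x. w k x = map_matrix complex_of_real (diag_sqrt (Dmat S k)) *v mmse_est S k x"
  shows "has_bochner_integral (prob_sp S) (\<lambda>x. herm_inner (w l x) (chan S k x))
      (of_real (\<Sum>m\<in>UNIV. sqrt (mr_pow m l) * mr_mean m l k))"
    and "has_bochner_integral (prob_sp S) (\<lambda>x. (cmod (herm_inner (w l x) (chan S k x)))\<^sup>2)
      ((\<Sum>m\<in>UNIV. mr_pow m l * ((if l = k then 0 else (hbar S m l)\<^sup>2 * (hbar S m k)\<^sup>2) + (hbar S m l)\<^sup>2 * beta S m k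
        + est_var m l * ((hbar S m k)\<^sup>2 + beta S m k)))
       + (\<Sum>m\<in>UNIV. sqrt (mr_pow m l) * mr_mean m l k)\<^sup>2)"
proof -
  have "w l x $ m = (\<Sum>j\<in>UNIV. if j = m then of_real (sqrt (mr_pow m l)) * mmse_est S l x $ m else 0)" for x m
    unfolding w diag_forms diag_sqrt_diag unfolding matrix_vector_mult_def map_matrix_def diag_def vec_lambda_beta
    by (rule sum.cong) auto
  then have expand: "herm_inner (w l x) (chan S k x)
      = (\<Sum>m\<in>UNIV. of_real (sqrt (mr_pow m l)) * (cnj (mmse_est S l x $ m) * chan S k x $ m))" for x
    by (simp add: herm_inner_def mult_ac)
  have "has_bochner_integral (prob_sp S) (\<lambda>x. herm_inner (w l x) (chan S k x))
      (\<Sum>m\<in>UNIV. of_real (sqrt (mr_pow m l)) * of_real (mr_mean m l k))"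
    unfolding expand by (intro has_bochner_integral_sum has_bochner_integral_mult_right ap_moments)
  then show "has_bochner_integral (prob_sp S) (\<lambda>x. herm_inner (w l x) (chan S k x))
      (of_real (\<Sum>m\<in>UNIV. sqrt (mr_pow m l) * mr_mean m l k))"
    by simp
  have eq: "complex_of_real (sqrt (mr_pow m l)) * complex_of_real (mr_mean m l k)
      = complex_of_real (sqrt (mr_pow m l) * mr_mean m l k)" for m
    by simp
  show "has_bochner_integral (prob_sp S) (\<lambda>x. (cmod (herm_inner (w l x) (chan S k x)))\<^sup>2)
      ((\<Sum>m\<in>UNIV. mr_pow m l * ((if l = k then 0 else (hbar S m l)\<^sup>2 * (hbar S m k)\<^sup>2) + (hbar S m l)\<^sup>2 * beta S m k
        + est_var m l * ((hbar S m k)\<^sup>2 + beta S m k)))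
       + (\<Sum>m\<in>UNIV. sqrt (mr_pow m l) * mr_mean m l k)\<^sup>2)"
    using second_moment_sum[where I=UNIV and c="\<lambda>m. of_real (sqrt (mr_pow m l))"
        and X="\<lambda>m x. cnj (mmse_est S l x $ m) * chan S k x $ m", OF finite ap_moments[of l _ k] indep_aps[of _ _ l k]]
    unfolding expand eq of_real_sum[symmetric] norm_of_real power2_abs
    by (simp add: mr_pow_nonneg)
qed

section \<open>Translation into traces and the effective SINR\<close>

lemma mr_mean_eq:
  "mr_mean m k k = est_var m k + (hbar S m k)\<^sup>2"
  "l \<noteq> k \<Longrightarrow> mr_mean m l k = (if l \<in> copilot S k then sqrt (pilot_pow S k * pilot_pow S l) * pilot_len S
     * (beta S m k * beta S m l / lam S m l) else 0)"
  using less_imp_le[OF pilot_pow_pos[of k]]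
  by (auto simp: mr_mean_def est_var_def est_gain_def pilot_amp_def copilot_def power2_eq_square real_sqrt_mult)

lemma trace_sqrt_Dmat_Zmat:
  "trace (diag_sqrt (Dmat S k) ** Zmat S k) = (\<Sum>m\<in>UNIV. sqrt (mr_pow m k) * mr_mean m k k)"
  by (simp add: diag_forms diag_sqrt_diag diag_mult trace_diag mr_mean_eq)

text \<open>The three cases are one quantity, the squared mean. For \<open>l = k\<close> the
  defining expression is the binomial expansion given by splitting \<open>Zmat\<close>; for other
  co-pilot users the root of the powers is squared; otherwise the mean is 0.\<close>

lemma Delta_eq: "Delta S l k = (\<Sum>m\<in>UNIV. sqrt (mr_pow m l) * mr_mean m l k)\<^sup>2"
proof (cases "l = k")
  case True
  have "trace (diag_sqrt (Dmat S k) ** Zmat S k)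
      = pilot_pow S k * pilot_len S * trace (diag_sqrt (Dmat S k) ** Ommat S k) + trace (diag_sqrt (Dmat S k) ** Lmat S k)"
    by (simp add: diag_forms diag_sqrt_diag Lmat_def diag_mult trace_diag est_var_def sum_distrib_left sum.distrib algebra_simps)
  then show ?thesis
    using True trace_sqrt_Dmat_Zmat[of k]
    by (simp add: Delta_def power2_sum power_mult_distrib)
next
  case False
  show ?thesis
  proof (cases "l \<in> copilot S k")
    case True
    have "(\<Sum>m\<in>UNIV. sqrt (mr_pow m l) * mr_mean m l k)
        = sqrt (pilot_pow S k * pilot_pow S l) * pilot_len S
          * trace (diag_sqrt (Dmat S l) ** Rmat S k ** Lammat S l ** Rmat S l)"
      using True False
      by (simp add: mr_mean_eq(2) diag_forms diag_sqrt_diag Rmat_def diag_mult trace_diag sum_distrib_left mult_ac)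
    then show ?thesis
      using True False less_imp_le[OF pilot_pow_pos]
      by (simp add: Delta_def power_mult_distrib)
  next
    case notin: False
    then show ?thesis using False by (simp add: Delta_def mr_mean_eq(2))
  qed
qed

text \<open>Isolates the term \<open>l = k\<close>, which is exactly the squared mean subtracted in
  the denominator of the SINR.\<close>

lemma sum_Delta:
  "(\<Sum>l\<in>UNIV. Delta S l k) = (\<Sum>l\<in>copilot S k - {k}. pilot_pow S k * pilot_pow S l * (pilot_len S)\<^sup>2
       * \<bar>trace (diag_sqrt (Dmat S l) ** Rmat S k ** Lammat S l ** Rmat S l)\<bar>\<^sup>2)
     + (trace (diag_sqrt (Dmat S k) ** Zmat S k))\<^sup>2" (is "_ = sum ?X _ + ?T")
proof -
  have "Delta S l k = (if l \<in> copilot S k - {k} then ?X l else 0) + (if l = k then ?T else 0)" for l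
    by (cases "l = k") (simp_all add: Delta_eq[of k k] trace_sqrt_Dmat_Zmat, simp add: Delta_def)
  then show ?thesis
    by (simp add: sum.distrib sum.If_cases del: Diff_iff)
qed

end

theorem theorem4:
  fixes S :: "('w, 'm::finite, 'k::finite, 't::finite) cell_free"
    and w :: "'k \<Rightarrow> 'w \<Rightarrow> complex ^ 'm"
  assumes model: "cell_free_model S"
    and mr_precoding: "\<And>k x. w k x = map_matrix complex_of_real (diag_sqrt (Dmat S k)) *v mmse_est S k x"
  shows "(\<forall>k. (\<integral>x. herm_inner (w k x) (chan S k x) \<partial>prob_sp S)
            = complex_of_real (trace (diag_sqrt (Dmat S k) ** Zmat S k)))
    \<and> (\<forall>k l. (\<integral>x. (cmod (herm_inner (w l x) (chan S k x)))\<^sup>2 \<partial>prob_sp S)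
            = pilot_pow S l * pilot_len S * trace (Dmat S l ** Rmat S k ** Ommat S l)
              + pilot_pow S l * pilot_len S * trace (Dmat S l ** Ommat S l ** Lmat S k)
              + trace (Dmat S l ** Smat S l k)
              + trace (Dmat S l ** Rmat S k ** Lmat S l)
              + Delta S l k)
    \<and> (\<forall>k. sinr_dl_coh S w k = sinr_dl_mmse S k)"
proof (intro conjI allI)
  interpret cell_free_model S by (rule model)
  note moments = mr_product_moments[OF mr_precoding]
  show mean: "(\<integral>x. herm_inner (w k x) (chan S k x) \<partial>prob_sp S)
      = complex_of_real (trace (diag_sqrt (Dmat S k) ** Zmat S k))" for k
    using has_bochner_integral_integral_eq[OF moments(1)[of k k]] by (simp add: trace_sqrt_Dmat_Zmat)
  have DS: "trace (Dmat S l ** Smat S l k) = (\<Sum>m\<in>UNIV. mr_pow m l * (if l = k then 0 else (hbar S m l)\<^sup>2 * (hbar S m k)\<^sup>2))"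
    for k l
    by (simp add: Smat_def diag_forms Lmat_def diag_mult trace_diag) (simp add: trace_def matrix_matrix_mult_def)
  show second: "(\<integral>x. (cmod (herm_inner (w l x) (chan S k x)))\<^sup>2 \<partial>prob_sp S)
      = pilot_pow S l * pilot_len S * trace (Dmat S l ** Rmat S k ** Ommat S l)
        + pilot_pow S l * pilot_len S * trace (Dmat S l ** Ommat S l ** Lmat S k)
        + trace (Dmat S l ** Smat S l k)
        + trace (Dmat S l ** Rmat S k ** Lmat S l)
        + Delta S l k" for k l
    unfolding has_bochner_integral_integral_eq[OF moments(2)] DS Delta_eq
    by (simp add: diag_forms diag_sqrt_diag Rmat_def Lmat_def diag_mult trace_diag est_var_def sum_distrib_left
        algebra_simps add_divide_distrib flip: sum.distrib)
  \<comment> \<open>The product of \<open>Rmat'\<close> and \<open>Zmat\<close> contains the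
    line-of-sight product for every \<open>l\<close>, whereas \<open>Smat\<close> is 0 for
    \<open>l = k\<close>; hence the correction by the squared \<open>Lmat\<close>.\<close>
  have "(\<integral>x. (cmod (herm_inner (w l x) (chan S k x)))\<^sup>2 \<partial>prob_sp S)
      = trace (Dmat S l ** Rmat' S k ** Zmat S l) - (if l = k then trace (Dmat S k ** (Lmat S k ** Lmat S k)) else 0)
        + Delta S l k" for k l
    unfolding has_bochner_integral_integral_eq[OF moments(2)] Delta_eq
    by (simp add: diag_forms diag_sqrt_diag Rmat'_def Rmat_def Lmat_def diag_mult diag_add trace_diag
        algebra_simps power2_eq_square flip: sum.distrib sum_subtractf)
  then show "sinr_dl_coh S w k = sinr_dl_mmse S k" for k
    unfolding sinr_dl_coh_def sinr_dl_mmse_def mean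
    by (simp add: sum.distrib sum_subtractf sum_Delta)
qed

end
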